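(* Let $H$ be a monoid. The following are equivalent: (a) $H$ is factorial. (b) $H$ is atomic and every atom of $H$ is powerful.
   Context: Let $H$ be a multiplicatively written monoid (not necessarily commutative or cancellative) with group of units $H^\times$. An atom of $H$ is an element $a \in H \setminus H^\times$ such that $a \ne xy$ for all $x,y \in H\setminus H^\times$; $\mathscr A(H)$ is the set of atoms. Write $x \simeq_H y$ if $x \in H^\times y H^\times$. $\mathscr F(\mathscr A(H))$ is the free monoid on the set $\mathscr A(H)$, with operation $\ast$ (concatenation) and empty word $\varepsilon$; $\pi_H:\mathscr F(\mathscr A(H))\to H$ is the monoid homomorphism with $\pi_H(a)=a$ for all $a\in\mathscr A(H)$. For $x\in H$, $\mathcal Z_H(x) := \{\mathfrak a\in\mathscr F(\mathscr A(H)) : \pi_H(\mathfrak a)=x\}$. $H$ is atomic if $\mathcal Z_H(x)\neq\emptyset$ for every $x\in H\setminus H^\times$. $\mathscr C_H$ is the congruence on $\mathscr F(\mathscr A(H))$ with $\mathfrak a \equiv\mathfrak b \bmod \mathscr C_H$ iff either $\mathfrak a=\mathfrak b=\varepsilon$, or $\mathfrak a=a_1\ast\cdots\ast a_n$ and $\mathfrak b=b_1\ast\cdots\ast b_n$ have the same length $n\ge1$, $\pi_H(\mathfrak a)=\pi_H(\mathfrak b)$, and there is a permutation $\sigma$ of $\{1,\dots,n\}$ with $a_i\simeq_H b_{\sigma(i)}$ for all $i$. $\mathsf Z_H(x)$ is the set of $\mathscr C_H$-classes of elements of $\mathcal Z_H(x)$. $H$ is factorial if $|\mathsf Z_H(x)|=1$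 for every $x\in H\setminus H^\times$. For $a\in\mathscr A(H)$, $\mathsf v_a^H:\mathscr F(\mathscr A(H))\to\mathbf N$ maps the empty word to $0$ and a word $a_1\ast\cdots\ast a_n$ of length $n\ge1$ to the number of indices $i\in\{1,\dots,n\}$ with $a_i\simeq_H a$. The atom $a$ is powerful if $\mathsf v_a^H(\mathfrak b)=\mathsf v_a^H(\mathfrak c)$ for all $\mathfrak b,\mathfrak c\in\mathscr F(\mathscr A(H))$ with $\pi_H(\mathfrak b)=\pi_H(\mathfrak c)$. *)

theory Defs
  imports "HOL-Algebra.Group" "HOL-Combinatorics.Permutations"
begin

definition atoms :: "('a, 'b) monoid_scheme \<Rightarrow> 'a set"
  where "atoms H = {a \<in> carrier H - Units H.
    \<forall>x \<in> carrier H - Units H. \<forall>y \<in> carrier H - Units H. a \<noteq> x \<otimes>\<^bsub>H\<^esub> y}"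

definition unit_equiv :: "('a, 'b) monoid_scheme \<Rightarrow> 'a \<Rightarrow> 'a \<Rightarrow> bool"
  where "unit_equiv H x y \<longleftrightarrow> (\<exists>u \<in> Units H. \<exists>v \<in> Units H. x = u \<otimes>\<^bsub>H\<^esub> y \<otimes>\<^bsub>H\<^esub> v)"

text \<open>The free monoid on the atoms is \<open>lists (atoms H)\<close>, with \<open>@\<close> as operation and \<open>[]\<close> as the
  empty word.\<close>

definition word_prod :: "('a, 'b) monoid_scheme \<Rightarrow> 'a list \<Rightarrow> 'a"
  where "word_prod H w = foldr (\<lambda>x y. x \<otimes>\<^bsub>H\<^esub> y) w \<one>\<^bsub>H\<^esub>"

definition atom_words :: "('a, 'b) monoid_scheme \<Rightarrow> 'a \<Rightarrow> 'a list set"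
  where "atom_words H x = {w \<in> lists (atoms H). word_prod H w = x}"

definition atomic :: "('a, 'b) monoid_scheme \<Rightarrow> bool"
  where "atomic H \<longleftrightarrow> (\<forall>x \<in> carrier H - Units H. atom_words H x \<noteq> {})"

definition word_cong :: "('a, 'b) monoid_scheme \<Rightarrow> ('a list \<times> 'a list) set"
  where "word_cong H = {(v, w). v \<in> lists (atoms H) \<and> w \<in> lists (atoms H) \<and>
    (v = [] \<and> w = [] \<or>
     length v \<ge> 1 \<and> length v = length w \<and> word_prod H v = word_prod H w \<and>
     (\<exists>\<sigma>. \<sigma> permutes {..<length v} \<and>
        (\<forall>i < length v. unit_equiv H (v ! i) (w ! \<sigma> i))))}"

definition factorization_classes :: "('a, 'b) monoid_scheme \<Rightarrow> 'a \<Rightarrow> 'a list set set"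
  where "factorization_classes H x = atom_words H x // word_cong H"

definition factorial_monoid :: "('a, 'b) monoid_scheme \<Rightarrow> bool"
  where "factorial_monoid H \<longleftrightarrow>
    (\<forall>x \<in> carrier H - Units H. card (factorization_classes H x) = 1)"

definition atom_val :: "('a, 'b) monoid_scheme \<Rightarrow> 'a \<Rightarrow> 'a list \<Rightarrow> nat"
  where "atom_val H a w = card {i. i < length w \<and> unit_equiv H (w ! i) a}"

definition powerful :: "('a, 'b) monoid_scheme \<Rightarrow> 'a \<Rightarrow> bool"
  where "powerful H a \<longleftrightarrow> (\<forall>v \<in> lists (atoms H). \<forall>w \<in> lists (atoms H).
    word_prod H v = word_prod H w \<longrightarrow> atom_val H a v = atom_val H a w)"

lemma (in monoid) unit_equiv_refl:
  assumes "x \<in> carrier G"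
  shows "unit_equiv G x x"
  unfolding unit_equiv_def using assms by (intro bexI[of _ "\<one>"]) auto

lemma (in monoid) unit_equiv_sym:
  assumes "y \<in> carrier G" "unit_equiv G x y"
  shows "unit_equiv G y x"
proof -
  obtain u v where uv: "u \<in> Units G" "v \<in> Units G" "x = u \<otimes> y \<otimes> v"
    using assms(2) unfolding unit_equiv_def by blast
  have "inv u \<otimes> x \<otimes> inv v = (inv u \<otimes> u) \<otimes> y \<otimes> (v \<otimes> inv v)"
    unfolding uv(3) using uv(1,2) assms(1) Units_closed Units_inv_closed
    by (simp add: m_assoc del: Units_l_inv Units_r_inv)
  then have "y = inv u \<otimes> x \<otimes> inv v"
    using uv(1,2) assms(1) by simp
  then show ?thesis
    unfolding unit_equiv_def using uv(1,2) by blast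
qed

lemma (in monoid) unit_equiv_trans:
  assumes "z \<in> carrier G" "unit_equiv G x y" "unit_equiv G y z"
  shows "unit_equiv G x z"
proof -
  obtain u v where uv: "u \<in> Units G" "v \<in> Units G" "x = u \<otimes> y \<otimes> v"
    using assms(2) unfolding unit_equiv_def by blast
  obtain s t where st: "s \<in> Units G" "t \<in> Units G" "y = s \<otimes> z \<otimes> t"
    using assms(3) unfolding unit_equiv_def by blast
  have "x = (u \<otimes> s) \<otimes> z \<otimes> (t \<otimes> v)"
    unfolding uv(3) st(3) using uv(1,2) st(1,2) assms(1) by (simp add: m_assoc Units_closed)
  then show ?thesis
    unfolding unit_equiv_def using uv(1,2) st(1,2) by blast
qed

lemma (in monoid) equiv_word_cong: "equiv (lists (atoms G)) (word_cong G)"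
proof (rule equivI)
  have carr: "w ! i \<in> carrier G" if "w \<in> lists (atoms G)" "i < length w" for w i
    using that nth_mem[of i w] by (auto simp: atoms_def)
  show "word_cong G \<subseteq> lists (atoms G) \<times> lists (atoms G)"
    by (auto simp: word_cong_def)
  show "refl_on (lists (atoms G)) (word_cong G)"
  proof (rule refl_onI)
    fix w assume w: "w \<in> lists (atoms G)"
    have "id permutes {..<length w} \<and> (\<forall>i < length w. unit_equiv G (w ! i) (w ! id i))"
      using carr[OF w] unit_equiv_refl permutes_id by simp
    then have "\<exists>\<sigma>. \<sigma> permutes {..<length w} \<and> (\<forall>i < length w. unit_equiv G (w ! i) (w ! \<sigma> i))"
      by (intro exI[of _ id])
    moreover have "w = [] \<or> length w \<ge> 1" by (cases w) auto
    ultimately show "(w, w) \<in> word_cong G"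
      using w unfolding word_cong_def by simp
  qed
  show "sym (word_cong G)"
  proof (rule symI)
    fix v w assume vw: "(v, w) \<in> word_cong G"
    show "(w, v) \<in> word_cong G"
    proof (cases "v = []")
      case True
      with vw show ?thesis by (simp add: word_cong_def)
    next
      case False
      with vw obtain p where *: "v \<in> lists (atoms G)" "w \<in> lists (atoms G)"
        "length v = length w" "word_prod G v = word_prod G w" "p permutes {..<length v}"
        "\<forall>i < length v. unit_equiv G (v ! i) (w ! p i)"
        by (auto simp: word_cong_def)
      have "unit_equiv G (w ! i) (v ! inv_into UNIV p i)" if "i < length w" for i
      proof -
        have lt: "inv_into UNIV p i < length v"
          using permutes_in_image[OF permutes_inv[OF *(5)], of i] that *(3) by simp
        have "unit_equiv G (v ! inv_into UNIV p i) (w ! i)"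
          using *(6) lt permutes_inverses(1)[OF *(5)] by metis
        then show ?thesis
          using unit_equiv_sym carr[OF *(2) that] by blast
      qed
      moreover have "inv_into UNIV p permutes {..<length w}"
        using permutes_inv[OF *(5)] *(3) by simp
      moreover have "length w \<ge> 1" using False *(3) by (cases w) auto
      ultimately show ?thesis using * unfolding word_cong_def by auto
    qed
  qed
  show "trans (word_cong G)"
  proof (rule transI)
    fix v w z assume vw: "(v, w) \<in> word_cong G" and wz: "(w, z) \<in> word_cong G"
    show "(v, z) \<in> word_cong G"
    proof (cases "v = []")
      case True
      with vw wz show ?thesis by (auto simp: word_cong_def)
    next
      case False
      with vw obtain p where p: "v \<in> lists (atoms G)" "w \<in> lists (atoms G)"
        "length v = length w" "word_prod G v = word_prod G w" "p permutes {..<length v}"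
        "\<forall>i < length v. unit_equiv G (v ! i) (w ! p i)"
        by (auto simp: word_cong_def)
      with False wz obtain q where q: "z \<in> lists (atoms G)"
        "length w = length z" "word_prod G w = word_prod G z" "q permutes {..<length w}"
        "\<forall>i < length w. unit_equiv G (w ! i) (z ! q i)"
        by (auto simp: word_cong_def)
      have "unit_equiv G (v ! i) (z ! (q \<circ> p) i)" if "i < length v" for i
      proof -
        have lp: "p i < length w"
          using permutes_in_image[OF p(5), of i] that p(3) by simp
        have lq: "q (p i) < length z"
          using permutes_in_image[OF q(4), of "p i"] lp q(2) by simp
        show ?thesis
          using unit_equiv_trans[OF carr[OF q(1) lq]] p(6) q(5) that lp by auto
      qed
      moreover have "q \<circ> p permutes {..<length v}"
        using permutes_compose[OF p(5)] q(4) p(3) by simp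
      moreover have "length v \<ge> 1" using False by (cases v) auto
      ultimately show ?thesis using p q unfolding word_cong_def by auto
    qed
  qed
qed

end

theory Submission
  imports Defs
begin

text \<open>
  A word of atoms determines a multiset of \<open>\<simeq>\<close>-classes, and the valuations \<open>atom_val\<close> are
  exactly the multiplicities in that multiset. Hence two words of the same product are congruent iff
  all valuations agree on them (\<open>word_cong_iff_atom_val\<close>), so that both conditions of the theorem
  require, besides atomicity, the same thing of an element \<open>x\<close>: that any two words with product
  \<open>x\<close> have equal valuations. The one difference lies in the range of \<open>x\<close>: factoriality looks only at non-units,
  whereas powerfulness also compares words whose product is a unit. In a monoid that is not
  Dedekind-finite a product of non-units may well be a unit, but this cannot happen for atoms: a
  right-invertible atom \<open>a\<close>, say \<open>a b = 1\<close>, would decompose as \<open>a = a (b a)\<close> into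
  non-units. So the empty word is the only word whose product is a unit
  (\<open>word_prod_Units_iff\<close>).
\<close>

definition unit_class :: "('a, 'b) monoid_scheme \<Rightarrow> 'a \<Rightarrow> 'a set"
  where "unit_class H a = {b \<in> carrier H. unit_equiv H b a}"

context monoid
begin

lemma unit_class_eq_iff:
  assumes "a \<in> carrier G" "b \<in> carrier G"
  shows "unit_class G a = unit_class G b \<longleftrightarrow> unit_equiv G a b"
proof
  assume "unit_class G a = unit_class G b"
  then show "unit_equiv G a b"
    using assms unit_equiv_refl unfolding unit_class_def by blast
next
  assume "unit_equiv G a b"
  then show "unit_class G a = unit_class G b"
    using assms unit_equiv_sym unit_equiv_trans unfolding unit_class_def by blast
qed

lemma nth_atom_word_closed:
  assumes "w \<in> lists (atoms G)" "i < length w"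
  shows "w ! i \<in> carrier G"
  using assms nth_mem[of i w] by (auto simp: atoms_def)

lemma word_prod_closed:
  assumes "w \<in> lists (atoms G)"
  shows "word_prod G w \<in> carrier G"
  using assms by (induction w) (auto simp: word_prod_def atoms_def)

lemma atom_not_right_invertible:
  assumes a: "a \<in> atoms G" and b: "b \<in> carrier G"
  shows "a \<otimes> b \<noteq> \<one>"
proof
  assume ab: "a \<otimes> b = \<one>"
  have ac: "a \<in> carrier G" "a \<notin> Units G"
    using a by (auto simp: atoms_def)
  have idem: "(b \<otimes> a) \<otimes> (b \<otimes> a) = b \<otimes> a"
    using ab ac b by (metis m_assoc m_closed r_one)
  have "b \<otimes> a \<notin> Units G"
  proof
    assume unit: "b \<otimes> a \<in> Units G"
    \<comment> \<open>A unit that is idempotent is the identity, which makes \<open>b\<close> a two-sided inverse of \<open>a\<close>.\<close>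
    have "(b \<otimes> a) \<otimes> (b \<otimes> a) = (b \<otimes> a) \<otimes> \<one>"
      using idem ac b by simp
    then have "b \<otimes> a = \<one>"
      using Units_l_cancel[OF unit, of "b \<otimes> a" "\<one>"] ac b by simp
    then show False
      using ab ac b unfolding Units_def by blast
  qed
  moreover have "a = a \<otimes> (b \<otimes> a)"
    using ab ac b by (metis m_assoc l_one)
  ultimately show False
    using a ac b unfolding atoms_def by blast
qed

text \<open>If a nonempty word multiplied to a unit, its first letter would be right-invertible.\<close>

lemma word_prod_Units_iff:
  assumes "w \<in> lists (atoms G)"
  shows "word_prod G w \<in> Units G \<longleftrightarrow> w = []"
proof (cases w)
  case Nil
  then show ?thesis by (simp add: word_prod_def)
next
  case (Cons a w')
  have a: "a \<in> atoms G" "a \<in> carrier G" and w': "word_prod G w' \<in> carrier G"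
    using assms Cons word_prod_closed by (auto simp: atoms_def)
  have "a \<otimes> word_prod G w' \<notin> Units G"
  proof
    assume u: "a \<otimes> word_prod G w' \<in> Units G"
    then have "a \<otimes> (word_prod G w' \<otimes> inv (a \<otimes> word_prod G w')) = \<one>"
      using a w' by (metis Units_inv_closed Units_r_inv m_assoc)
    then show False
      using atom_not_right_invertible[OF a(1)] u w' by simp
  qed
  then show ?thesis
    using Cons by (simp add: word_prod_def)
qed

lemma atom_val_eq_count:
  assumes "a \<in> atoms G" "w \<in> lists (atoms G)"
  shows "atom_val G a w = count (mset (map (unit_class G) w)) (unit_class G a)"
proof -
  have "unit_equiv G (w ! i) a \<longleftrightarrow> unit_class G a = unit_class G (w ! i)" if "i < length w" for i
    using unit_class_eq_iff[of "w ! i" a] nth_atom_word_closed[OF assms(2) that] assms(1)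
    by (auto simp: atoms_def)
  then have "{i. i < length w \<and> unit_equiv G (w ! i) a} =
    {i. i < length w \<and> unit_class G a = map (unit_class G) w ! i}"
    by auto
  then show ?thesis
    unfolding atom_val_def count_mset count_list_eq_length_filter length_filter_conv_card
    by (auto intro!: arg_cong[where f = card])
qed

text \<open>
  The valuations at atoms see the whole multiset, because every class occurring in a word of atoms
  is the class of an atom.
\<close>

lemma atom_val_eq_iff_mset:
  assumes v: "v \<in> lists (atoms G)" and w: "w \<in> lists (atoms G)"
  shows "(\<forall>a \<in> atoms G. atom_val G a v = atom_val G a w) \<longleftrightarrow>
    mset (map (unit_class G) v) = mset (map (unit_class G) w)"
proof
  assume eq: "\<forall>a \<in> atoms G. atom_val G a v = atom_val G a w"
  show "mset (map (unit_class G) v) = mset (map (unit_class G) w)"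
  proof (rule multiset_eqI)
    fix C
    show "count (mset (map (unit_class G) v)) C = count (mset (map (unit_class G) w)) C"
    proof (cases "C \<in> unit_class G ` atoms G")
      case True
      then show ?thesis
        using eq atom_val_eq_count v w by auto
    next
      case False
      then have "C \<notin># mset (map (unit_class G) v)" "C \<notin># mset (map (unit_class G) w)"
        using v w by auto
      then show ?thesis
        by (metis not_in_iff)
    qed
  qed
next
  assume "mset (map (unit_class G) v) = mset (map (unit_class G) w)"
  then show "\<forall>a \<in> atoms G. atom_val G a v = atom_val G a w"
    using atom_val_eq_count v w by simp
qed

text \<open>
  Replacing letters by their classes turns matching up to \<open>\<simeq>\<close> into equality, so a matching
  permutation is just a rearrangement of one list of classes into the other.
\<close>

lemma mset_unit_class_eq_iff_permutes:
  assumes v: "v \<in> lists (atoms G)" and w: "w \<in> lists (atoms G)"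
  shows "mset (map (unit_class G) v) = mset (map (unit_class G) w) \<longleftrightarrow>
    length v = length w \<and>
    (\<exists>p. p permutes {..<length v} \<and> (\<forall>i < length v. unit_equiv G (v ! i) (w ! p i)))"
    (is "?M \<longleftrightarrow> ?P")
proof
  assume m: ?M
  have len: "length v = length w"
    using mset_eq_length[OF m] by simp
  obtain p where p: "p permutes {..<length w}"
    and pl: "permute_list p (map (unit_class G) w) = map (unit_class G) v"
    using mset_eq_permutation[OF m] by auto
  have "unit_equiv G (v ! i) (w ! p i)" if i: "i < length v" for i
  proof -
    have pi: "p i < length w"
      using permutes_in_image[OF p, of i] i len by simp
    have "unit_class G (v ! i) = permute_list p (map (unit_class G) w) ! i"
      using pl i by simp
    also have "\<dots> = unit_class G (w ! p i)"
      using permute_list_nth[of p "map (unit_class G) w" i] p i pi len by simp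
    finally show ?thesis
      using unit_class_eq_iff nth_atom_word_closed v w i pi by blast
  qed
  then show ?P
    using len p by auto
next
  assume ?P
  then obtain p where len: "length v = length w" and p: "p permutes {..<length w}"
    and eqv: "\<forall>i < length v. unit_equiv G (v ! i) (w ! p i)"
    by auto
  have "map (unit_class G) v = permute_list p (map (unit_class G) w)"
  proof (rule nth_equalityI)
    fix i assume "i < length (map (unit_class G) v)"
    then have i: "i < length v" by simp
    have pi: "p i < length w"
      using permutes_in_image[OF p, of i] i len by simp
    have "unit_class G (v ! i) = unit_class G (w ! p i)"
      using unit_class_eq_iff nth_atom_word_closed v w i pi eqv by blast
    then show "map (unit_class G) v ! i = permute_list p (map (unit_class G) w) ! i"
      using permute_list_nth[of p "map (unit_class G) w" i] p i pi len by simp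
  qed (simp add: len)
  then show ?M
    using mset_permute_list[of p "map (unit_class G) w"] p by simp
qed

lemma word_cong_iff_atom_val:
  assumes v: "v \<in> lists (atoms G)" and w: "w \<in> lists (atoms G)"
  shows "(v, w) \<in> word_cong G \<longleftrightarrow>
    word_prod G v = word_prod G w \<and> (\<forall>a \<in> atoms G. atom_val G a v = atom_val G a w)"
proof (cases "v = []")
  case True
  \<comment> \<open>Then agreement of all valuations forces the other word to be empty as well.\<close>
  then show ?thesis
    unfolding atom_val_eq_iff_mset[OF v w] using w by (auto simp: word_cong_def)
next
  case False
  then have "length v \<ge> 1" by (cases v) auto
  then show ?thesis
    unfolding atom_val_eq_iff_mset[OF v w] mset_unit_class_eq_iff_permutes[OF v w] word_cong_def
      mem_Collect_eq case_prod_conv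
    using v w False by blast
qed

lemma card_factorization_classes_eq_1_iff:
  "card (factorization_classes G x) = 1 \<longleftrightarrow>
    atom_words G x \<noteq> {} \<and> (\<forall>v \<in> atom_words G x. \<forall>w \<in> atom_words G x. (v, w) \<in> word_cong G)"
proof -
  have sub: "atom_words G x \<subseteq> lists (atoms G)"
    by (auto simp: atom_words_def)
  have img: "factorization_classes G x = (\<lambda>v. word_cong G `` {v}) ` atom_words G x"
    by (auto simp: factorization_classes_def quotient_def)
  have "card (factorization_classes G x) = 1 \<longleftrightarrow> atom_words G x \<noteq> {} \<and>
    (\<forall>v \<in> atom_words G x. \<forall>w \<in> atom_words G x. word_cong G `` {v} = word_cong G `` {w})"
    (is "_ \<longleftrightarrow> ?A \<noteq> {} \<and> (\<forall>v \<in> ?A. \<forall>w \<in> ?A. ?f v = ?f w)")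
  proof
    assume "card (factorization_classes G x) = 1"
    then obtain C where C: "?f ` ?A = {C}"
      unfolding img by (auto simp: card_1_singleton_iff)
    then have "?A \<noteq> {}" by (metis image_empty insert_not_empty)
    moreover have "?f v = C" if "v \<in> ?A" for v
      using imageI[OF that, of ?f] unfolding C by simp
    ultimately show "?A \<noteq> {} \<and> (\<forall>v \<in> ?A. \<forall>w \<in> ?A. ?f v = ?f w)"
      by simp
  next
    assume one: "?A \<noteq> {} \<and> (\<forall>v \<in> ?A. \<forall>w \<in> ?A. ?f v = ?f w)"
    then obtain v where v: "v \<in> ?A" by (metis all_not_in_conv)
    have "?f w = ?f v" if "w \<in> ?A" for w
      using conjunct2[OF one, rule_format, OF that v] .
    then have "?f ` ?A = (\<lambda>_. ?f v) ` ?A"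
      by (rule image_cong[OF refl])
    also have "\<dots> = {?f v}"
      using v by (rule image_constant)
    finally have "?f ` ?A = {?f v}" .
    then show "card (factorization_classes G x) = 1"
      unfolding img by simp
  qed
  moreover have "word_cong G `` {v} = word_cong G `` {w} \<longleftrightarrow> (v, w) \<in> word_cong G"
    if "v \<in> atom_words G x" "w \<in> atom_words G x" for v w
    using that sub by (intro eq_equiv_class_iff[OF equiv_word_cong]) auto
  ultimately show ?thesis
    by simp
qed

end

theorem theorem5p9:
  fixes H :: "('a, 'b) monoid_scheme"
  assumes "monoid H"
  shows "factorial_monoid H \<longleftrightarrow> atomic H \<and> (\<forall>a \<in> atoms H. powerful H a)"
proof -
  interpret monoid H by (rule assms)
  show ?thesis
  proof
    assume fac: "factorial_monoid H"
    have "atomic H"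
      using fac card_factorization_classes_eq_1_iff
      unfolding factorial_monoid_def atomic_def by blast
    moreover have "atom_val H a v = atom_val H a w"
      if a: "a \<in> atoms H" and v: "v \<in> lists (atoms H)" and w: "w \<in> lists (atoms H)"
        and eq: "word_prod H v = word_prod H w" for a v w
    proof (cases "word_prod H v \<in> Units H")
      case True
      then show ?thesis
        using word_prod_Units_iff v w eq by metis
    next
      case False
      then have "word_prod H v \<in> carrier H - Units H"
        using word_prod_closed v by simp
      moreover have "v \<in> atom_words H (word_prod H v)" "w \<in> atom_words H (word_prod H v)"
        using v w eq by (auto simp: atom_words_def)
      ultimately have "(v, w) \<in> word_cong H"
        using fac card_factorization_classes_eq_1_iff unfolding factorial_monoid_def by blast
      then show ?thesis
        using word_cong_iff_atom_val v w a by blast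
    qed
    ultimately show "atomic H \<and> (\<forall>a \<in> atoms H. powerful H a)"
      unfolding powerful_def by blast
  next
    assume rhs: "atomic H \<and> (\<forall>a \<in> atoms H. powerful H a)"
    have "(v, w) \<in> word_cong H" if "v \<in> atom_words H x" "w \<in> atom_words H x" for v w x
    proof -
      have "v \<in> lists (atoms H)" "w \<in> lists (atoms H)" "word_prod H v = word_prod H w"
        using that by (auto simp: atom_words_def)
      then show ?thesis
        using word_cong_iff_atom_val rhs unfolding powerful_def by blast
    qed
    then show "factorial_monoid H"
      using rhs card_factorization_classes_eq_1_iff
      unfolding factorial_monoid_def atomic_def by blast
  qed
qed

end
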